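(* Let $\{a_n\}_{n\geqslant 1}$ be a sequence of positive real numbers and let $N\geqslant 1$ be an integer. Suppose that there are sequences of positive real numbers $h_n, f_n, g_n$ $(n\geqslant N)$ such that for all $n\geqslant N$ \[ a_n\leqslant h_n,\qquad f_n\leqslant \frac{a_{n+1}}{a_n}\leqslant g_n, \] and \[ 2\log h_n+n(n+1)\log g_{n+1}-n(n+3)\log f_n\leqslant 0 . \] Then the root sequence $\{\sqrt[n]{a_n}\}_{n\geqslant N}$ is log-concave.
   Context: A sequence $\{c_n\}_{n\geqslant N}$ is log-concave if $c_n^2\geqslant c_{n+1}c_{n-1}$ for all $n\geqslant N+1$. *)

theory Defs
  imports Complex_Main
begin

(* Only the values c n with n >= N matter; since n >= N + 1 below, the natural-number
   subtraction n - 1 does not truncate. *)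
definition log_concave_from :: "nat \<Rightarrow> (nat \<Rightarrow> real) \<Rightarrow> bool" where
  "log_concave_from N c \<longleftrightarrow> (\<forall>n\<ge>N + 1. (c n)\<^sup>2 \<ge> c (n + 1) * c (n - 1))"

end

theory Submission
  imports Defs
begin

text \<open>
  With \<open>L n = ln (a n)\<close>, log-concavity of the root sequence at the index \<open>m + 1\<close> says that
  \<open>L n / n\<close> is midpoint concave there. Multiplying the second difference by \<open>m * (m + 1) * (m + 2)\<close>
  and expressing \<open>L (m + 1)\<close> and \<open>L (m + 2)\<close> through \<open>L m\<close> and the two successive increments
  \<open>x = L (m + 1) - L m\<close>, \<open>y = L (m + 2) - L (m + 1)\<close>, the coefficient of \<open>L m\<close>
  is \<open>m * (m + 1) + (m + 1) * (m + 2) - 2 * m * (m + 2) = 2\<close>, and the condition becomes \<open>2 * L m + m * (m + 1) * y - m * (m + 3) * x \<le> 0\<close>.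
  The left-hand side increases with \<open>L m\<close> and \<open>y\<close> and decreases with \<open>x\<close>, so replacing these by
  the bounds \<open>ln (h m)\<close>, \<open>ln (g (m + 1))\<close> and \<open>ln (f m)\<close> can only make it larger; the
  hypothesis says that it is nonpositive even then.
\<close>

text \<open>
  The two sides differ by the positive factor \<open>m * (m + 1) * (m + 2)\<close>. The right-hand side involves
  \<open>q\<close> and \<open>r\<close> only through increments, so that bounds on successive ratios of a sequence apply to it
  when \<open>p\<close>, \<open>q\<close>, \<open>r\<close> are logarithms.
\<close>

lemma averages_midpoint_concave_iff:
  fixes m p q r :: real
  assumes "m > 0"
  shows "r / (m + 2) + p / m \<le> 2 * (q / (m + 1)) \<longleftrightarrow>
    2 * p + m * (m + 1) * (r - q) - m * (m + 3) * (q - p) \<le> 0"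
proof -
  define P Q R where "P = p / m" and "Q = q / (m + 1)" and "R = r / (m + 2)"
  then have "p = m * P" "q = (m + 1) * Q" "r = (m + 2) * R"
    using assms by simp_all
  then have "2 * p + m * (m + 1) * (r - q) - m * (m + 3) * (q - p)
      = (m * (m + 1) * (m + 2)) * (R + P - 2 * Q)"
    by (simp add: algebra_simps)
  moreover have "m * (m + 1) * (m + 2) > 0"
    using assms by simp
  ultimately have "2 * p + m * (m + 1) * (r - q) - m * (m + 3) * (q - p) \<le> 0 \<longleftrightarrow>
      R + P - 2 * Q \<le> 0"
    by (smt (verit) mult_le_0_iff)
  then show ?thesis
    by (simp add: P_def Q_def R_def)
qed

lemma root_eq_exp_ln:
  assumes "n > 0" "x > 0"
  shows "root n x = exp (ln x / real n)"
  using assms by (metis exp_ln ln_root real_root_gt_zero)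

lemma roots_log_concave_iff:
  fixes p q r :: real and m :: nat
  assumes "m > 0" "p > 0" "q > 0" "r > 0"
  shows "root (m + 2) r * root m p \<le> (root (m + 1) q)\<^sup>2 \<longleftrightarrow>
    2 * ln p + real m * (real m + 1) * (ln r - ln q) - real m * (real m + 3) * (ln q - ln p) \<le> 0"
proof -
  have "root (m + 2) r * root m p \<le> (root (m + 1) q)\<^sup>2 \<longleftrightarrow>
      ln r / (real m + 2) + ln p / real m \<le> 2 * (ln q / (real m + 1))"
    using assms by (simp add: root_eq_exp_ln power2_eq_square add.commute flip: exp_add)
  also have "\<dots> \<longleftrightarrow>
      2 * ln p + real m * (real m + 1) * (ln r - ln q) - real m * (real m + 3) * (ln q - ln p) \<le> 0"
    using assms by (intro averages_midpoint_concave_iff) simp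
  finally show ?thesis .
qed

theorem theorem3p1:
  fixes a h f g :: "nat \<Rightarrow> real" and N :: nat
  assumes "\<And>n. n \<ge> 1 \<Longrightarrow> a n > 0"
    and "N \<ge> 1"
    and "\<And>n. n \<ge> N \<Longrightarrow> h n > 0"
    and "\<And>n. n \<ge> N \<Longrightarrow> f n > 0"
    and "\<And>n. n \<ge> N \<Longrightarrow> g n > 0"
    and "\<And>n. n \<ge> N \<Longrightarrow> a n \<le> h n"
    and "\<And>n. n \<ge> N \<Longrightarrow> f n \<le> a (n + 1) / a n"
    and "\<And>n. n \<ge> N \<Longrightarrow> a (n + 1) / a n \<le> g n"
    and "\<And>n. n \<ge> N \<Longrightarrow>
           2 * ln (h n) + real n * (real n + 1) * ln (g (n + 1))
             - real n * (real n + 3) * ln (f n) \<le> 0"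
  shows "log_concave_from N (\<lambda>n. root n (a n))"
  unfolding log_concave_from_def
proof (intro allI impI)
  fix n assume "N + 1 \<le> n"
  (* The bounds at an index m control a m, a (m + 1), a (m + 2), so the middle index n is m + 1. *)
  then obtain m where n: "n = m + 1" and m: "N \<le> m" "m > 0"
    using assms(2) by (cases n) auto
  have pos: "a m > 0" "a (m + 1) > 0" "a (m + 2) > 0"
    using m by (auto intro: assms(1))
  have "ln (a m) \<le> ln (h m)"
    using assms(6)[OF m(1)] pos by (intro ln_mono) auto
  moreover have "ln (f m) \<le> ln (a (m + 1)) - ln (a m)"
    using assms(7)[OF m(1)] assms(4)[OF m(1)] pos
    by (metis ln_divide_pos ln_mono)
  moreover have "ln (a (m + 2)) - ln (a (m + 1)) \<le> ln (g (m + 1))"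
  proof -
    have "a (m + 2) / a (m + 1) \<le> g (m + 1)"
      using assms(8)[of "m + 1"] m by simp
    then have "ln (a (m + 2) / a (m + 1)) \<le> ln (g (m + 1))"
      using pos by (intro ln_mono) auto
    then show ?thesis
      using pos by (simp add: ln_divide_pos)
  qed
  ultimately have "2 * ln (a m)
      + real m * (real m + 1) * (ln (a (m + 2)) - ln (a (m + 1)))
      - real m * (real m + 3) * (ln (a (m + 1)) - ln (a m))
    \<le> 2 * ln (h m) + real m * (real m + 1) * ln (g (m + 1)) - real m * (real m + 3) * ln (f m)"
    by (intro diff_mono add_mono mult_left_mono) auto
  also have "\<dots> \<le> 0"
    by (rule assms(9)[OF m(1)])
  finally have "root (m + 2) (a (m + 2)) * root m (a m) \<le> (root (m + 1) (a (m + 1)))\<^sup>2"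
    using roots_log_concave_iff[OF m(2) pos] by blast
  then show "root (n + 1) (a (n + 1)) * root (n - 1) (a (n - 1)) \<le> (root n (a n))\<^sup>2"
    by (simp add: n)
qed

end
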